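(* (1) Let $u\in C_{+,\log}$ be (log, exp)-convex. Then its $L$-function $\mathcal L_u$ is also (log, exp)-convex, and for any constant $a>1$, $$\mathcal L_u(r)\le \frac{ea}{\log a}\,u(ar)\qquad\text{for all } r\ge0.$$ (2) Let $u\in C_{+,\log}$ be increasing and (log, $x^k$)-convex for some $k>0$. Then there exists a constant $C$, independent of $k$ (that is, depending only on $u$ and valid for every $k>0$ for which $u$ is (log, $x^k$)-convex), such that $$u(r)\le C\,\mathcal L_u(2^k r)\qquad\text{for all } r\ge 0.$$
   Context: $C_{+,\log}$ denotes the set of all positive continuous functions $u:[0,\infty)\to(0,\infty)$ with $\lim_{r\to\infty}\frac{\log u(r)}{\log r}=\infty$. For $u\in C_{+,\log}$ the Legendre transform is $\ell_u(t)=\inf_{r>0}\frac{u(r)}{r^t}$, $t\in[0,\infty)$. When $\lim_{n\to\infty}\ell_u(n)^{1/n}=0$ (which holds for the functions considered here), the $L$-function of $u$ is $\mathcal L_u(r)=\sum_{n=0}^\infty \ell_u(n)r^n$, $r\ge0$. A positive continuous function $u$ on $[0,\infty)$ is (log, exp)-convex if $x\mapsto\log u(e^x)$ is convex on $\mathbb R$; for a real number $k>0$, it is (log, $x^k$)-convex if $x\mapsto\log u(x^k)$ is convex on $[0,\infty)$. "Increasing" is meant in the non-strict sense. *)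

theory Defs
  imports "HOL-Analysis.Analysis"
begin

text \<open>
  Functions on \<open>[0,\<infinity>)\<close> are rendered as total functions on the reals of which only
  the values on \<open>{0..}\<close> are used.
\<close>

definition C_plus_log :: "(real \<Rightarrow> real) set" where
  "C_plus_log = {u. continuous_on {0..} u \<and> (\<forall>r\<ge>0. 0 < u r) \<and>
                    filterlim (\<lambda>r. ln (u r) / ln r) at_top at_top}"

definition legendre :: "(real \<Rightarrow> real) \<Rightarrow> real \<Rightarrow> real" where
  "legendre u t = (INF r\<in>{0<..}. u r / r powr t)"

text \<open>
  For members of \<open>C_plus_log\<close> the series converges for every \<open>r \<ge> 0\<close> and the root
  condition on the coefficients holds; see the two lemmas below.
\<close>

definition L_function :: "(real \<Rightarrow> real) \<Rightarrow> real \<Rightarrow> real" where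
  "L_function u r = (\<Sum>n. legendre u (real n) * r ^ n)"

definition log_exp_convex :: "(real \<Rightarrow> real) \<Rightarrow> bool" where
  "log_exp_convex u \<longleftrightarrow> continuous_on {0..} u \<and> (\<forall>r\<ge>0. 0 < u r) \<and>
     convex_on UNIV (\<lambda>x. ln (u (exp x)))"

text \<open>Only used for \<open>k > 0\<close>, where \<open>0 powr k = 0\<close> is the intended value at the endpoint.\<close>

definition log_powr_convex :: "real \<Rightarrow> (real \<Rightarrow> real) \<Rightarrow> bool" where
  "log_powr_convex k u \<longleftrightarrow> continuous_on {0..} u \<and> (\<forall>r\<ge>0. 0 < u r) \<and>
     convex_on {0..} (\<lambda>x. ln (u (x powr k)))"

lemma legendre_bounds:
  assumes "u \<in> C_plus_log" "r > 0"
  shows "0 \<le> legendre u t" "legendre u t \<le> u r / r powr t"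
proof -
  have pos: "\<And>s. 0 < s \<Longrightarrow> 0 \<le> u s / s powr t"
    using assms(1) by (simp add: C_plus_log_def less_imp_le)
  show "0 \<le> legendre u t"
    unfolding legendre_def by (rule cINF_greatest) (use pos in auto)
  show "legendre u t \<le> u r / r powr t"
    unfolding legendre_def
    by (rule cINF_lower) (use pos assms(2) in \<open>auto intro!: bdd_belowI2[where m = 0]\<close>)
qed

lemma summable_L_function:
  assumes u: "u \<in> C_plus_log" and r: "r \<ge> 0"
  shows "summable (\<lambda>n. legendre u (real n) * r ^ n)"
proof (rule summable_comparison_test')
  show "summable (\<lambda>n. u (r + 1) * (r / (r + 1)) ^ n)"
    by (intro summable_mult summable_geometric) (use r in simp)
  fix n :: nat
  have "legendre u (real n) * r ^ n \<le> u (r + 1) / (r + 1) powr real n * r ^ n"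
    by (intro mult_right_mono legendre_bounds) (use u r in auto)
  also have "\<dots> = u (r + 1) * (r / (r + 1)) ^ n"
    using r by (simp add: powr_realpow power_divide)
  finally show "norm (legendre u (real n) * r ^ n) \<le> u (r + 1) * (r / (r + 1)) ^ n"
    using legendre_bounds(1)[OF u zero_less_one] r by simp
qed

lemma root_legendre_tendsto_0:
  assumes u: "u \<in> C_plus_log"
  shows "(\<lambda>n. root n (legendre u (real n))) \<longlonglongrightarrow> 0"
proof (rule order_tendstoI)
  fix e :: real assume "e < 0"
  then show "\<forall>\<^sub>F n in sequentially. e < root n (legendre u (real n))"
    using legendre_bounds(1)[OF u zero_less_one]
    by (intro always_eventually) (meson less_le_trans real_root_ge_zero)
next
  fix e :: real assume e: "0 < e"
  define r where "r = 2 / e"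
  have r: "r > 0" "1 / r < e" using e by (auto simp: r_def)
  have "u r > 0" using u r by (simp add: C_plus_log_def)
  then have "(\<lambda>n. root n (u r) / r) \<longlonglongrightarrow> 1 / r"
    by (intro tendsto_divide LIMSEQ_root_const) (use r in auto)
  then have "\<forall>\<^sub>F n in sequentially. root n (u r) / r < e"
    using r(2) by (rule order_tendstoD)
  with eventually_gt_at_top[of 0]
  show "\<forall>\<^sub>F n in sequentially. root n (legendre u (real n)) < e"
  proof eventually_elim
    case (elim n)
    have "root n (legendre u (real n)) \<le> root n (u r / r powr real n)"
      using elim legendre_bounds(2)[OF u r(1)] by simp
    also have "\<dots> = root n (u r) / r"
      using elim r by (simp add: powr_realpow real_root_divide real_root_power_cancel)
    finally show ?case using elim by simp
  qed
qed

end

theory Submission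
  imports Defs
begin

text \<open>
  Convexity of the \<open>L\<close>-function comes from the shape of the series. A power
  series with nonnegative coefficients is, in the variable \<open>x = ln r\<close>, a sum of exponentials
  \<open>c\<^sub>n exp (n x)\<close>, and such sums are log-convex by Hoelder's inequality
  (\<open>log_exp_convex_power_series\<close>). For the upper bound, testing the infimum in \<open>legendre u n\<close> at the point \<open>a r\<close> gives
  \<open>legendre u n * r^n \<le> u (a r) / a^n\<close>; the geometric series sums to \<open>a / (a - 1) * u (a r)\<close>,
  and \<open>ln a \<le> a - 1\<close> does the rest.

  For the lower bound, a single term of the series is large enough. Let \<open>y\<^sub>n\<close> minimise \<open>u s / s^n\<close>,
  so that the infimum is attained: \<open>legendre u n * y\<^sub>n^n = u y\<^sub>n\<close>. If \<open>r \<le> y\<^sub>n \<le> 2 powr k * r\<close>, then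
  the \<open>n\<close>-th term at \<open>2 powr k * r\<close> is at least \<open>u y\<^sub>n \<ge> u r\<close>. It remains to find such an \<open>n\<close>, so the
  points \<open>y\<^sub>n\<close> must be unbounded (\<open>minimizers_unbounded\<close>) and must not jump too far. In the coordinate
  \<open>x = s powr (1/k)\<close> the function \<open>f x = ln (u (x powr k))\<close> is convex, and minimality of
  \<open>f x - k n ln x\<close> at \<open>x\<^sub>n = y\<^sub>n powr (1/k)\<close> says that \<open>k n / x\<^sub>n\<close> is a slope of \<open>f\<close> there. Slopes of a
  convex function increase, hence \<open>x\<^bsub>n+1\<^esub> \<le> ((n+1)/n) x\<^sub>n \<le> 2 x\<^sub>n\<close>, that is
  \<open>y\<^bsub>n+1\<^esub> \<le> 2 powr k * y\<^sub>n\<close> (\<open>minimizer_step\<close>). The least \<open>n\<close> with \<open>y\<^sub>n \<ge> r\<close> therefore works as soon as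
  \<open>n \<ge> 2\<close>. The only remaining range is \<open>r \<le> y\<^sub>1\<close>, where \<open>u r \<le> u y\<^sub>1\<close> is compared with the constant
  term of the series; \<open>y\<^sub>1\<close> depends on \<open>u\<close> alone, and this is why the constant does not depend
  on \<open>k\<close>.
\<close>

section \<open>Members of the function class and their Legendre transform\<close>

lemma C_plus_logD:
  assumes "u \<in> C_plus_log"
  shows "continuous_on {0..} u" "r \<ge> 0 \<Longrightarrow> 0 < u r"
    "filterlim (\<lambda>r. ln (u r) / ln r) at_top at_top"
  using assms by (auto simp: C_plus_log_def)

lemma C_plus_log_eventually_ge_power:
  assumes u: "u \<in> C_plus_log"
  shows "\<forall>\<^sub>F r in at_top. r ^ n \<le> u r"
proof -
  have "\<forall>\<^sub>F r in at_top. real n \<le> ln (u r) / ln r"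
    using C_plus_logD(3)[OF u] by (simp add: filterlim_at_top)
  with eventually_gt_at_top[of 1] show ?thesis
  proof eventually_elim
    case (elim r)
    then have "real n * ln r \<le> ln (u r)" by (simp add: pos_le_divide_eq)
    then have "ln (r ^ n) \<le> ln (u r)" using elim by (simp add: ln_realpow)
    then show ?case using elim C_plus_logD(2)[OF u, of r] by simp
  qed
qed

lemma C_plus_log_bounded_below:
  assumes u: "u \<in> C_plus_log"
  obtains c where "c > 0" "\<And>r. r \<ge> 0 \<Longrightarrow> c \<le> u r"
proof -
  obtain R where R: "\<And>r. r \<ge> R \<Longrightarrow> 1 \<le> u r"
    using C_plus_log_eventually_ge_power[OF u, of 0] by (auto simp: eventually_at_top_linorder)
  have "continuous_on {0..max 0 R} u"
    using C_plus_logD(1)[OF u] by (rule continuous_on_subset) auto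
  then obtain x where x: "x \<in> {0..max 0 R}" "\<And>y. y \<in> {0..max 0 R} \<Longrightarrow> u x \<le> u y"
    using continuous_attains_inf[of "{0..max 0 R}" u] by auto
  show ?thesis
  proof (rule that)
    show "min 1 (u x) > 0" using x(1) C_plus_logD(2)[OF u] by simp
    show "min 1 (u x) \<le> u r" if "r \<ge> 0" for r
    proof (cases "r \<le> R")
      case True
      then have "u x \<le> u r" using that by (intro x(2)) auto
      then show ?thesis by simp
    next
      case False
      then have "1 \<le> u r" by (intro R) auto
      then show ?thesis by simp
    qed
  qed
qed

lemma legendre_greatest:
  assumes "\<And>s. s > 0 \<Longrightarrow> c \<le> u s / s powr t"
  shows "c \<le> legendre u t"
  unfolding legendre_def by (rule cINF_greatest) (use assms in auto)

lemma legendre_nonneg: "u \<in> C_plus_log \<Longrightarrow> 0 \<le> legendre u t"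
  using legendre_bounds(1)[OF _ zero_less_one] .

lemma legendre_0_pos:
  assumes u: "u \<in> C_plus_log"
  shows "0 < legendre u 0"
proof -
  obtain c where c: "c > 0" "\<And>r. r \<ge> 0 \<Longrightarrow> c \<le> u r"
    using C_plus_log_bounded_below[OF u] by blast
  have "c \<le> legendre u 0"
    by (rule legendre_greatest) (use c in auto)
  then show ?thesis using c(1) by simp
qed

lemma L_function_0: "L_function u 0 = legendre u 0"
  using powser_sums_zero[of "\<lambda>n. legendre u (real n)"] by (simp add: L_function_def sums_iff)

lemma L_function_ge_term:
  assumes "u \<in> C_plus_log" "r \<ge> 0"
  shows "legendre u (real n) * r ^ n \<le> L_function u r"
  using sum_le_suminf[OF summable_L_function[OF assms], of "{n}"] assms
  by (simp add: L_function_def legendre_nonneg)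

section \<open>Log-convexity of power series with nonnegative coefficients\<close>

text \<open>
  This is Hoelder's inequality for the series, obtained by applying convexity of \<open>exp\<close> to each term
  after normalising the two endpoint series to sum \<open>1\<close>. Positivity of the constant coefficient
  makes the sum positive at \<open>0\<close> as well.
\<close>

lemma log_exp_convex_power_series:
  fixes c :: "nat \<Rightarrow> real"
  assumes c0: "c 0 > 0" and c: "\<And>n. c n \<ge> 0"
    and summ: "\<And>r. r \<ge> 0 \<Longrightarrow> summable (\<lambda>n. c n * r ^ n)"
  shows "log_exp_convex (\<lambda>r. \<Sum>n. c n * r ^ n)"
proof -
  define F where "F r = (\<Sum>n. c n * r ^ n)" for r
  have pos: "F r > 0" if "r \<ge> 0" for r
  proof -
    have "c 0 \<le> F r"
      using sum_le_suminf[OF summ[OF that], of "{0}"] c that by (simp add: F_def)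
    with c0 show ?thesis by simp
  qed
  have cont: "continuous_on {0..} F"
  proof (rule continuous_at_imp_continuous_on, rule ballI)
    fix r :: real assume r: "r \<in> {0..}"
    then show "isCont F r"
      unfolding F_def by (intro isCont_powser[of c "r + 1"] summ) auto
  qed
  have conv: "convex_on UNIV (\<lambda>x. ln (F (exp x)))"
  proof (rule convex_onI)
    fix t x y :: real assume t: "t > 0" "t < 1"
    define z where "z = (1 - t) *\<^sub>R x + t *\<^sub>R y"
    define lx where "lx = ln (F (exp x))"
    define ly where "ly = ln (F (exp y))"
    define M where "M = (1 - t) * lx + t * ly"
    have expl: "exp lx = F (exp x)" "exp ly = F (exp y)"
      using pos by (auto simp: lx_def ly_def)
    have sx: "(\<lambda>n. c n * exp x ^ n) sums exp lx" and sy: "(\<lambda>n. c n * exp y ^ n) sums exp ly"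
      and sz: "(\<lambda>n. c n * exp z ^ n) sums F (exp z)"
      unfolding expl F_def by (intro summable_sums summ; simp)+
    have "c n * exp z ^ n * exp (- M)
        \<le> (1 - t) * (c n * exp x ^ n * exp (- lx)) + t * (c n * exp y ^ n * exp (- ly))" for n
    proof -
      have "exp ((1 - t) *\<^sub>R (n * x - lx) + t *\<^sub>R (n * y - ly))
          \<le> (1 - t) * exp (n * x - lx) + t * exp (n * y - ly)"
        using convex_onD[OF exp_convex] t by simp
      also have "(1 - t) *\<^sub>R (n * x - lx) + t *\<^sub>R (n * y - ly) = n * z - M"
        by (simp add: z_def M_def algebra_simps)
      finally have "c n * exp (n * z - M)
          \<le> c n * ((1 - t) * exp (n * x - lx) + t * exp (n * y - ly))"
        by (intro mult_left_mono c)
      moreover have "exp (n * v - w) = exp v ^ n * exp (- w)" for v w :: real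
        by (simp add: exp_diff exp_minus exp_of_nat_mult divide_inverse)
      ultimately show ?thesis
        by (simp only: distrib_left mult.assoc mult.left_commute)
    qed
    moreover have "(\<lambda>n. c n * exp z ^ n * exp (- M)) sums (F (exp z) * exp (- M))"
      by (intro sums_mult2 sz)
    moreover have "(\<lambda>n. (1 - t) * (c n * exp x ^ n * exp (- lx)) + t * (c n * exp y ^ n * exp (- ly)))
        sums ((1 - t) * (exp lx * exp (- lx)) + t * (exp ly * exp (- ly)))"
      by (intro sums_add sums_mult sums_mult2 sx sy)
    ultimately have "F (exp z) * exp (- M)
        \<le> (1 - t) * (exp lx * exp (- lx)) + t * (exp ly * exp (- ly))"
      by (rule sums_le)
    also have "\<dots> = 1" by (simp flip: exp_add)
    finally have "F (exp z) \<le> exp M" by (simp add: exp_minus field_simps)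
    then have "ln (F (exp z)) \<le> ln (exp M)" using pos[of "exp z"] by (subst ln_le_cancel_iff) auto
    then have "ln (F (exp z)) \<le> M" by simp
    then show "ln (F (exp ((1 - t) *\<^sub>R x + t *\<^sub>R y)))
        \<le> (1 - t) * ln (F (exp x)) + t * ln (F (exp y))"
      by (simp add: z_def M_def lx_def ly_def)
  qed simp
  show ?thesis using pos cont conv unfolding log_exp_convex_def F_def by blast
qed

lemma log_exp_convex_L_function:
  assumes u: "u \<in> C_plus_log"
  shows "log_exp_convex (L_function u)"
proof -
  have "log_exp_convex (\<lambda>r. \<Sum>n. legendre u (real n) * r ^ n)"
    by (rule log_exp_convex_power_series)
      (use u in \<open>auto simp: legendre_0_pos legendre_nonneg summable_L_function\<close>)
  then show ?thesis by (simp add: L_function_def[abs_def])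
qed

section \<open>The upper bound\<close>

text \<open>
  For \<open>r > 0\<close> each infimum \<open>legendre u n\<close> is tested at the same point \<open>a r\<close>. That point is excluded
  from the infimum when \<open>r = 0\<close>; there \<open>L_function u 0\<close> is the infimum of \<open>u\<close> over \<open>{0<..}\<close>, and
  continuity of \<open>u\<close> at \<open>0\<close> supplies the estimate.
\<close>

lemma L_function_le_geometric:
  assumes u: "u \<in> C_plus_log" and a: "a > 1" and r: "r \<ge> 0"
  shows "L_function u r \<le> a / (a - 1) * u (a * r)"
proof (cases "r = 0")
  case True
  have "(u \<longlongrightarrow> u 0) (at 0 within {0..})"
    using C_plus_logD(1)[OF u] by (simp add: continuous_on_def)
  then have "(u \<longlongrightarrow> u 0) (at_right 0)"
    by (rule tendsto_within_subset) auto
  moreover have "\<forall>\<^sub>F s in at_right 0. legendre u 0 \<le> u s"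
    using eventually_at_right_less[of 0]
  proof eventually_elim
    case (elim s)
    then show ?case using legendre_bounds(2)[OF u, of s 0] by simp
  qed
  ultimately have "legendre u 0 \<le> u 0"
    by (intro tendsto_lowerbound[of u "u 0" "at_right 0"]) auto
  also have "\<dots> = 1 * u 0" by simp
  also have "\<dots> \<le> a / (a - 1) * u 0"
    using a C_plus_logD(2)[OF u, of 0] by (intro mult_right_mono) (auto simp: field_simps)
  finally show ?thesis using True by (simp add: L_function_0)
next
  case False
  with r a have r: "r > 0" and ar: "a * r > 0" by auto
  have "legendre u (real n) * r ^ n \<le> u (a * r) * (1 / a) ^ n" for n
  proof -
    have "legendre u (real n) * r ^ n \<le> u (a * r) / (a * r) powr real n * r ^ n"
      by (intro mult_right_mono legendre_bounds(2) u ar) (use r in simp)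
    also have "\<dots> = u (a * r) * (1 / a) ^ n"
      using r a ar by (simp add: powr_realpow power_mult_distrib field_simps)
    finally show ?thesis .
  qed
  moreover have "(\<lambda>n. legendre u (real n) * r ^ n) sums L_function u r"
    unfolding L_function_def using summable_L_function[OF u] r by (simp add: summable_sums)
  moreover have "(\<lambda>n. u (a * r) * (1 / a) ^ n) sums (u (a * r) * (1 / (1 - 1 / a)))"
    by (intro sums_mult geometric_sums) (use a in simp)
  ultimately have "L_function u r \<le> u (a * r) * (1 / (1 - 1 / a))"
    by (rule sums_le)
  also have "\<dots> = a / (a - 1) * u (a * r)"
    using a by (simp add: field_simps)
  finally show ?thesis .
qed

lemma L_function_le:
  assumes u: "u \<in> C_plus_log" and a: "a > 1" and r: "r \<ge> 0"
  shows "L_function u r \<le> exp 1 * a / ln a * u (a * r)"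
proof -
  have "a / (a - 1) \<le> a / ln a"
    using a ln_le_minus_one[of a] by (intro divide_left_mono) auto
  also have "\<dots> \<le> exp 1 * a / ln a"
    using a by (intro divide_right_mono) auto
  finally have "a / (a - 1) \<le> exp 1 * a / ln a" .
  then have "a / (a - 1) * u (a * r) \<le> exp 1 * a / ln a * u (a * r)"
    using C_plus_logD(2)[OF u, of "a * r"] a r by (intro mult_right_mono) auto
  with L_function_le_geometric[OF u a r] show ?thesis by linarith
qed

section \<open>Points where the infimum is attained\<close>

definition power_minimizer :: "(real \<Rightarrow> real) \<Rightarrow> nat \<Rightarrow> real \<Rightarrow> bool" where
  "power_minimizer u n y \<longleftrightarrow> y > 0 \<and> (\<forall>s>0. u y / y ^ n \<le> u s / s ^ n)"

lemma power_minimizerD: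
  assumes "power_minimizer u n y"
  shows "y > 0" "s > 0 \<Longrightarrow> u y / y ^ n \<le> u s / s ^ n"
  using assms by (auto simp: power_minimizer_def)

text \<open>
  The exponent must be positive: only then does \<open>u s / s^n\<close> blow up at \<open>0\<close>, so that the minimum
  over a compact interval is a minimum over all \<open>s > 0\<close>.
\<close>

lemma power_minimizer_exists:
  assumes u: "u \<in> C_plus_log" and n: "n \<ge> 1"
  shows "\<exists>y. power_minimizer u n y"
proof -
  obtain c where c: "c > 0" "\<And>r. r \<ge> 0 \<Longrightarrow> c \<le> u r"
    using C_plus_log_bounded_below[OF u] by blast
  obtain R where R: "\<And>r. r \<ge> R \<Longrightarrow> r ^ Suc n \<le> u r"
    using C_plus_log_eventually_ge_power[OF u, of "Suc n"] by (auto simp: eventually_at_top_linorder)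
  \<comment> \<open>Outside \<open>[a, b]\<close> the quotient is at least \<open>u 1\<close>, its value at \<open>1\<close>, which lies inside.\<close>
  define a where "a = min 1 (c / u 1)"
  define b where "b = max 1 (max R (u 1))"
  have u1: "u 1 > 0" using C_plus_logD(2)[OF u] by simp
  have ab: "0 < a" "a \<le> 1" "1 \<le> b" using c(1) u1 by (auto simp: a_def b_def)
  have "continuous_on {a..b} u"
    using C_plus_logD(1)[OF u] by (rule continuous_on_subset) (use ab in auto)
  then have "continuous_on {a..b} (\<lambda>s. u s / s ^ n)"
    using ab by (intro continuous_intros) auto
  then obtain y where y: "y \<in> {a..b}" "\<And>s. s \<in> {a..b} \<Longrightarrow> u y / y ^ n \<le> u s / s ^ n"
    using continuous_attains_inf[of "{a..b}" "\<lambda>s. u s / s ^ n"] ab by auto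
  have y1: "u y / y ^ n \<le> u 1" using y(2)[of 1] ab by simp
  have "u y / y ^ n \<le> u s / s ^ n" if s: "s > 0" for s
  proof -
    consider "s \<in> {a..b}" | "s < a" | "s > b" by fastforce
    then show ?thesis
    proof cases
      case 1
      then show ?thesis by (rule y(2))
    next
      case 2
      then have s1: "s \<le> 1" "s < c / u 1" by (auto simp: a_def)
      then have "u 1 * s ^ n \<le> u 1 * s"
        using power_decreasing[of 1 n s] n s u1 by simp
      also have "\<dots> \<le> c" using s1 u1 by (simp add: field_simps)
      also have "c \<le> u s" using c(2) s by simp
      finally have "u 1 \<le> u s / s ^ n" using s by (simp add: field_simps)
      with y1 show ?thesis by simp
    next
      case 3
      then have "u 1 \<le> s" "R \<le> s" by (auto simp: b_def)
      then have "u 1 * s ^ n \<le> s * s ^ n" using s by (intro mult_right_mono) auto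
      also have "\<dots> \<le> u s" using R[OF \<open>R \<le> s\<close>] by simp
      finally have "u 1 \<le> u s / s ^ n" using s by (simp add: field_simps)
      with y1 show ?thesis by simp
    qed
  qed
  then show ?thesis using y(1) ab unfolding power_minimizer_def by (intro exI[of _ y]) auto
qed

lemma le_legendre_power_minimizer:
  assumes y: "power_minimizer u n y"
  shows "u y \<le> legendre u (real n) * y ^ n"
proof -
  have "u y / y ^ n \<le> legendre u (real n)"
    by (rule legendre_greatest) (use y in \<open>auto simp: power_minimizer_def powr_realpow\<close>)
  then show ?thesis using y by (simp add: power_minimizer_def field_simps)
qed

text \<open>
  If all minimisers stayed below \<open>r\<close>, comparing with the value at \<open>2 r\<close> would give
  \<open>u (y n) \<le> u (2 r) / 2^n\<close>, which contradicts that \<open>u\<close> is bounded away from \<open>0\<close>.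
\<close>

lemma minimizers_unbounded:
  assumes u: "u \<in> C_plus_log" and y: "\<And>n. n \<ge> 1 \<Longrightarrow> power_minimizer u n (y n)"
  shows "\<exists>n\<ge>1. r \<le> y n"
proof (rule ccontr)
  assume "\<not> ?thesis"
  then have less: "y n < r" if "n \<ge> 1" for n using that by fastforce
  have ypos: "y n > 0" if "n \<ge> 1" for n using y[OF that] by (simp add: power_minimizer_def)
  have r: "r > 0" using less[of 1] ypos[of 1] by simp
  obtain c where c: "c > 0" "\<And>r. r \<ge> 0 \<Longrightarrow> c \<le> u r"
    using C_plus_log_bounded_below[OF u] by blast
  have bound: "c \<le> u (2 * r) * (1 / 2) ^ n" if n: "n \<ge> 1" for n
  proof -
    have "u (y n) / y n ^ n \<le> u (2 * r) / (2 * r) ^ n"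
      using power_minimizerD(2)[OF y[OF n], of "2 * r"] r by (simp del: power_mult_distrib)
    then have "u (y n) \<le> u (2 * r) / (2 * r) ^ n * y n ^ n"
      using ypos[OF n] by (simp add: field_simps)
    also have "\<dots> \<le> u (2 * r) / (2 * r) ^ n * r ^ n"
      using less[OF n] ypos[OF n] r C_plus_logD(2)[OF u, of "2 * r"]
      by (intro mult_left_mono power_mono) auto
    also have "\<dots> = u (2 * r) * (1 / 2) ^ n"
      using r by (simp add: power_mult_distrib field_simps)
    finally show ?thesis using c(2)[of "y n"] ypos[OF n] by simp
  qed
  have "(\<lambda>n. u (2 * r) * (1 / 2) ^ n) \<longlonglongrightarrow> u (2 * r) * 0"
    by (intro tendsto_mult tendsto_const LIMSEQ_power_zero) simp
  then have "\<forall>\<^sub>F n in sequentially. u (2 * r) * (1 / 2) ^ n < c"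
    using c(1) by (intro order_tendstoD) auto
  then have "\<forall>\<^sub>F n :: nat in sequentially. False"
    using eventually_ge_at_top[of 1] by eventually_elim (use bound in fastforce)
  then show False by simp
qed

section \<open>Consecutive minimisers are close\<close>

text \<open>
  Minimality at \<open>p\<close> says that \<open>f\<close> leaves \<open>p\<close> with slope at least \<open>\<alpha> / p\<close>, minimality at \<open>q\<close> that it
  reaches \<open>q\<close> with slope at most \<open>\<beta> / q\<close>; by convexity the chord slope \<open>S\<close> lies between them. To avoid derivatives, \<open>S\<close> is compared with
  difference quotients of \<open>ln\<close> at interior points \<open>x\<close> and \<open>y\<close>, which then tend to \<open>p\<close> and \<open>q\<close>.
\<close>

lemma convex_log_minimizers_ratio:
  fixes f :: "real \<Rightarrow> real"
  assumes f: "convex_on {p..q} f" and pq: "0 < p" "p < q" and ab: "\<alpha> > 0" "\<beta> > 0"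
    and minp: "\<And>x. x \<in> {p..q} \<Longrightarrow> f p - \<alpha> * ln p \<le> f x - \<alpha> * ln x"
    and minq: "\<And>x. x \<in> {p..q} \<Longrightarrow> f q - \<beta> * ln q \<le> f x - \<beta> * ln x"
  shows "\<alpha> * q \<le> \<beta> * p"
proof -
  define S where "S = (f q - f p) / (q - p)"
  have ln_ratio: "ln v - ln w \<le> (v - w) / w" if "v > 0" "w > 0" for v w :: real
    using ln_le_minus_one[of "v / w"] that by (simp add: ln_div field_simps)
  have lower: "\<alpha> / x \<le> S" if x: "p < x" "x < q" for x
  proof -
    have "\<alpha> * ((x - p) / x) \<le> \<alpha> * (ln x - ln p)"
      using ln_ratio[of p x] x pq ab by (intro mult_left_mono) (auto simp: field_simps)
    also have "\<dots> \<le> f x - f p" using minp[of x] x by (simp add: algebra_simps)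
    also have "\<dots> \<le> S * (x - p)"
      using convex_onD_Icc'[OF f, of x] x by (simp add: S_def)
    finally have "\<alpha> / x * (x - p) \<le> S * (x - p)" by simp
    then show ?thesis by (rule mult_right_le_imp_le) (use x in simp)
  qed
  have upper: "S \<le> \<beta> / y" if y: "p < y" "y < q" for y
  proof -
    have "(f p - f q) / (q - p) = - S"
      by (simp add: S_def minus_divide_left)
    then have "S * (q - y) \<le> f q - f y"
      using convex_onD_Icc''[OF f, of y] y by simp
    also have "\<dots> \<le> \<beta> * (ln q - ln y)" using minq[of y] y by (simp add: algebra_simps)
    also have "\<dots> \<le> \<beta> * ((q - y) / y)"
      using ln_ratio[of q y] y pq ab by (intro mult_left_mono) auto
    finally have "S * (q - y) \<le> \<beta> / y * (q - y)" by simp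
    then show ?thesis by (rule mult_right_le_imp_le) (use y in simp)
  qed
  have "\<alpha> * y / \<beta> \<le> x" if "p < x" "x < q" "p < y" "y < q" for x y
    using order_trans[OF lower upper, of x y] that pq ab by (simp add: field_simps)
  then have le_p: "\<alpha> * y / \<beta> \<le> p" if "p < y" "y < q" for y
    using that by (intro dense_ge_bounded[OF pq(2)]) auto
  have "y \<le> \<beta> * p / \<alpha>" if "p < y" "y < q" for y
    using le_p[OF that] ab by (simp add: field_simps)
  then have "q \<le> \<beta> * p / \<alpha>"
    by (intro dense_le_bounded[OF pq(2)]) auto
  then show ?thesis using ab by (simp add: field_simps)
qed

lemma power_minimizer_log:
  assumes u: "\<And>r. r \<ge> 0 \<Longrightarrow> 0 < u r"
    and y: "power_minimizer u n y" "y = p powr k" and p: "p > 0" and x: "x > 0"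
  shows "ln (u (p powr k)) - k * n * ln p \<le> ln (u (x powr k)) - k * n * ln x"
proof -
  have ln_quot: "ln (u (z powr k) / (z powr k) ^ n) = ln (u (z powr k)) - k * n * ln z"
    if "z > 0" for z
    using that u[of "z powr k"] by (simp add: ln_div ln_realpow ln_powr)
  have "u (p powr k) / (p powr k) ^ n \<le> u (x powr k) / (x powr k) ^ n"
    using y x by (simp add: power_minimizer_def)
  then have "ln (u (p powr k) / (p powr k) ^ n) \<le> ln (u (x powr k) / (x powr k) ^ n)"
    using u p x by (intro ln_mono) auto
  then show ?thesis using p x by (simp add: ln_quot)
qed

text \<open>
  In the coordinate \<open>s powr (1/k)\<close> the next minimiser exceeds the present one at most by the
  factor \<open>(m+1)/m\<close>, and \<open>m \<ge> 1\<close> bounds it by \<open>2\<close>.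
\<close>

lemma minimizer_step:
  assumes u: "log_powr_convex k u" and k: "k > 0" and m: "m \<ge> 1"
    and y: "power_minimizer u m y" and z: "power_minimizer u (Suc m) z"
  shows "z \<le> 2 powr k * y"
proof -
  define p where "p = y powr (1 / k)"
  define q where "q = z powr (1 / k)"
  have pos: "0 < y" "0 < z" "0 < p" "0 < q"
    using y z by (auto simp: power_minimizer_def p_def q_def)
  have yz: "y = p powr k" "z = q powr k"
    using pos k by (auto simp: p_def q_def powr_powr)
  have upos: "\<And>r. r \<ge> 0 \<Longrightarrow> 0 < u r" using u by (simp add: log_powr_convex_def)
  have "q \<le> 2 * p"
  proof (cases "p < q")
    case True
    have "convex_on {0..} (\<lambda>x. ln (u (x powr k)))"
      using u by (simp add: log_powr_convex_def)
    then have "convex_on {p..q} (\<lambda>x. ln (u (x powr k)))"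
      by (rule convex_on_subset) (use pos in auto)
    then have "k * m * q \<le> k * Suc m * p"
    proof (rule convex_log_minimizers_ratio)
      fix x assume "x \<in> {p..q}"
      then have x: "x > 0" using pos by auto
      show "ln (u (p powr k)) - k * m * ln p \<le> ln (u (x powr k)) - k * m * ln x"
        by (rule power_minimizer_log[OF upos y yz(1) pos(3) x])
      show "ln (u (q powr k)) - k * Suc m * ln q \<le> ln (u (x powr k)) - k * Suc m * ln x"
        by (rule power_minimizer_log[OF upos z yz(2) pos(4) x])
    qed (use pos True k m in auto)
    then have "m * q \<le> Suc m * p"
      using k by (simp add: mult.assoc)
    also have "\<dots> \<le> (2 * m) * p"
      using m pos by (intro mult_right_mono) auto
    finally show ?thesis using m by simp
  qed (use pos in simp)
  then have "z \<le> (2 * p) powr k" using pos k by (simp add: yz powr_mono2)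
  then show ?thesis using pos by (simp add: yz powr_mult)
qed

section \<open>The lower bound\<close>

lemma le_const_mult_L_function:
  assumes u: "u \<in> C_plus_log" and mono: "mono_on {0..} u"
  shows "\<exists>C. \<forall>k>0. log_powr_convex k u \<longrightarrow> (\<forall>r\<ge>0. u r \<le> C * L_function u (2 powr k * r))"
proof -
  have "\<exists>y. \<forall>n\<ge>1. power_minimizer u n (y n)"
    using power_minimizer_exists[OF u] by metis
  then obtain y where y: "\<And>n. n \<ge> 1 \<Longrightarrow> power_minimizer u n (y n)" by blast
  have ypos: "y n > 0" if "n \<ge> 1" for n using y[OF that] by (simp add: power_minimizer_def)
  \<comment> \<open>Chosen before \<open>k\<close>: the first entry serves \<open>r > y 1\<close>, the second one \<open>r \<le> y 1\<close>.\<close>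
  define C where "C = max 1 (u (y 1) / legendre u 0)"
  have "u r \<le> C * L_function u (2 powr k * r)"
    if k: "k > 0" and conv: "log_powr_convex k u" and r: "r \<ge> 0" for k r
  proof -
    define n where "n = (LEAST n. n \<ge> 1 \<and> r \<le> y n)"
    have n: "n \<ge> 1" "r \<le> y n"
      using LeastI_ex[of "\<lambda>n. n \<ge> 1 \<and> r \<le> y n"] minimizers_unbounded[OF u y, of r]
      by (auto simp: n_def)
    have le: "u r \<le> u (y n)"
      using mono_onD[OF mono] r n by auto
    have L: "legendre u (real j) * (2 powr k * r) ^ j \<le> L_function u (2 powr k * r)" for j
      using r by (intro L_function_ge_term[OF u]) simp
    show ?thesis
    proof (cases "n = 1")
      case True
      have l0: "legendre u 0 > 0" using legendre_0_pos[OF u] .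
      have "u r \<le> u (y 1) / legendre u 0 * legendre u 0" using le True l0 by simp
      also have "\<dots> \<le> C * L_function u (2 powr k * r)"
        using L[of 0] l0 by (intro mult_mono) (auto simp: C_def)
      finally show ?thesis .
    next
      case False
      then obtain m where m: "n = Suc m" "m \<ge> 1" using n(1) by (cases n) auto
      then have "y m < r"
        using not_less_Least[of m "\<lambda>n. n \<ge> 1 \<and> r \<le> y n"] by (auto simp: n_def)
      have "y n \<le> 2 powr k * y m"
        using minimizer_step[OF conv k m(2) y[OF m(2)], of "y n"] y[OF n(1)] m(1) by simp
      also have "\<dots> \<le> 2 powr k * r" using \<open>y m < r\<close> by simp
      finally have yn: "y n \<le> 2 powr k * r" .
      have "u (y n) \<le> legendre u (real n) * y n ^ n"
        by (rule le_legendre_power_minimizer[OF y[OF n(1)]])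
      also have "\<dots> \<le> legendre u (real n) * (2 powr k * r) ^ n"
        using yn ypos[OF n(1)] by (intro mult_left_mono power_mono legendre_nonneg[OF u]) auto
      also have "\<dots> \<le> 1 * L_function u (2 powr k * r)" using L by simp
      also have "\<dots> \<le> C * L_function u (2 powr k * r)"
        using order_trans[OF legendre_nonneg[OF u, of 0]] L[of 0]
        by (intro mult_right_mono) (auto simp: C_def)
      finally show ?thesis using le by simp
    qed
  qed
  then show ?thesis by blast
qed

theorem theorem3p13:
  fixes u :: "real \<Rightarrow> real"
  assumes "u \<in> C_plus_log"
  shows "(log_exp_convex u \<longrightarrow>
            log_exp_convex (L_function u) \<and>
            (\<forall>a>1. \<forall>r\<ge>0. L_function u r \<le> exp 1 * a / ln a * u (a * r))) \<and>
         (mono_on {0..} u \<and> (\<exists>k>0. log_powr_convex k u) \<longrightarrow>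
            (\<exists>C. \<forall>k>0. log_powr_convex k u \<longrightarrow>
                   (\<forall>r\<ge>0. u r \<le> C * L_function u (2 powr k * r))))"
  using log_exp_convex_L_function[OF assms] L_function_le[OF assms]
    le_const_mult_L_function[OF assms] by blast

end
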